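(* Let $\alpha\in\mathbb R$ not be an integer multiple of $\pi$. Let $\{V_j^\alpha : j\in\mathbb Z\}$ be a sequence of closed subspaces of $L^2(\mathbb R)$ satisfying the following conditions: (a) $V_k^\alpha\subseteq V_{k+1}^\alpha$ for all $k\in\mathbb Z$; (d) for all $k\in\mathbb Z$, $f(t)\in V_k^\alpha$ if and only if $f(2t)e^{\frac{i}{2}[(2t)^2-t^2]\cot\alpha}\in V_{k+1}^\alpha$; (e) there is a function $\phi\in V_0^\alpha$ such that $\{\phi(t-n)e^{-i(tn+n^2)\cot\alpha} : n\in\mathbb Z\}$ is an orthonormal basis of $V_0^\alpha$. Then $\bigcap_{j\in\mathbb Z}V_j^\alpha=\{0\}$. This is the case even if, in (e), one only assumes that $\{\phi(t-n)e^{-i(tn+n^2)\cot\alpha} : n\in\mathbb Z\}$ is a Riesz basis of $V_0^\alpha$.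
   Context: Here $i$ is the imaginary unit and functions are complex-valued functions of $t\in\mathbb R$. A system $\{f_k : k\in\mathbb Z\}$ of functions in $L^2(\mathbb R)$ is a Riesz basis of a closed subspace $\mathcal H$ of $L^2(\mathbb R)$ (to which the $f_k$ belong) if for any $f\in\mathcal H$ there is a sequence $\{a[k]\}_{k\in\mathbb Z}\in\ell^2(\mathbb Z)$ such that $f=\sum_{k\in\mathbb Z}a[k]f_k$ with convergence in $L^2(\mathbb R)$, and $$C_1\sum_{k\in\mathbb Z}|a[k]|^2\le\Big\|\sum_{k\in\mathbb Z}a[k]f_k\Big\|_2^2\le C_2\sum_{k\in\mathbb Z}|a[k]|^2,$$ where the constants $0<C_1\le C_2<\infty$ are independent of $f$. *)

theory Defs
  imports "HOL-Analysis.Analysis"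
begin

text \<open>
  Elements of \<open>L\<^sup>2(\<real>)\<close> are represented by functions rather than by their classes modulo equality
  almost everywhere. A subspace of \<open>L\<^sup>2(\<real>)\<close> is the set of all representatives of its elements:
  the limit clause of \<open>closed_subspace_L2\<close>, applied to a constant sequence, makes such a set closed
  under changes on null sets.
\<close>

definition L2 :: "(real \<Rightarrow> complex) set" where
  "L2 = {f. f \<in> borel_measurable lebesgue \<and> integrable lebesgue (\<lambda>t. (cmod (f t))\<^sup>2)}"

definition L2_norm :: "(real \<Rightarrow> complex) \<Rightarrow> real" where
  "L2_norm f = sqrt (LINT t|lebesgue. (cmod (f t))\<^sup>2)"

definition L2_inner :: "(real \<Rightarrow> complex) \<Rightarrow> (real \<Rightarrow> complex) \<Rightarrow> complex" where
  "L2_inner f g = (LINT t|lebesgue. f t * cnj (g t))"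

definition closed_subspace_L2 :: "(real \<Rightarrow> complex) set \<Rightarrow> bool" where
  "closed_subspace_L2 H \<longleftrightarrow>
     H \<subseteq> L2 \<and> (\<lambda>t. 0) \<in> H \<and>
     (\<forall>f\<in>H. \<forall>g\<in>H. (\<lambda>t. f t + g t) \<in> H) \<and>
     (\<forall>c. \<forall>f\<in>H. (\<lambda>t. c * f t) \<in> H) \<and>
     (\<forall>F. \<forall>f\<in>L2. (\<forall>n::nat. F n \<in> H) \<and> (\<lambda>n. L2_norm (\<lambda>t. F n t - f t)) \<longlonglongrightarrow> 0 \<longrightarrow> f \<in> H)"

text \<open>Convergence is unordered, i.e. along the net of finite sets of indices, as for \<open>has_sum\<close>.\<close>

definition L2_has_sum :: "(int \<Rightarrow> real \<Rightarrow> complex) \<Rightarrow> (real \<Rightarrow> complex) \<Rightarrow> bool" where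
  "L2_has_sum g f \<longleftrightarrow>
     ((\<lambda>F. L2_norm (\<lambda>t. (\<Sum>k\<in>F. g k t) - f t)) \<longlongrightarrow> 0) (finite_subsets_at_top UNIV)"

definition orthonormal_basis_L2 ::
    "(real \<Rightarrow> complex) set \<Rightarrow> (int \<Rightarrow> real \<Rightarrow> complex) \<Rightarrow> bool" where
  "orthonormal_basis_L2 H e \<longleftrightarrow>
     (\<forall>k. e k \<in> H) \<and>
     (\<forall>j k. L2_inner (e j) (e k) = (if j = k then 1 else 0)) \<and>
     (\<forall>f\<in>H. \<exists>a :: int \<Rightarrow> complex. L2_has_sum (\<lambda>k t. a k * e k t) f)"

text \<open>
  The two inequalities are imposed on the coefficient sequence that represents \<open>f\<close>. Requiring
  them of all square-summable sequences gives a stronger condition, so a theorem assuming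
  \<open>riesz_basis_L2\<close> covers that convention too.
\<close>

definition riesz_basis_L2 ::
    "(real \<Rightarrow> complex) set \<Rightarrow> (int \<Rightarrow> real \<Rightarrow> complex) \<Rightarrow> bool" where
  "riesz_basis_L2 H e \<longleftrightarrow>
     (\<forall>k. e k \<in> H) \<and>
     (\<exists>C1 C2 :: real. 0 < C1 \<and> C1 \<le> C2 \<and>
       (\<forall>f\<in>H. \<exists>a :: int \<Rightarrow> complex.
          (\<lambda>k. (cmod (a k))\<^sup>2) summable_on UNIV \<and>
          L2_has_sum (\<lambda>k t. a k * e k t) f \<and>
          C1 * (\<Sum>\<^sub>\<infinity>k. (cmod (a k))\<^sup>2) \<le> (L2_norm f)\<^sup>2 \<and>
          (L2_norm f)\<^sup>2 \<le> C2 * (\<Sum>\<^sub>\<infinity>k. (cmod (a k))\<^sup>2)))"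

definition chirp_translate ::
    "real \<Rightarrow> (real \<Rightarrow> complex) \<Rightarrow> int \<Rightarrow> real \<Rightarrow> complex" where
  "chirp_translate \<alpha> \<phi> n = (\<lambda>t. \<phi> (t - of_int n) *
     exp (- \<i> * complex_of_real ((t * of_int n + (of_int n)\<^sup>2) * cot \<alpha>)))"

end

theory Submission
  imports Defs
begin

text \<open>
  The chirps are unimodular, so only moduli matter. If \<open>f\<close> lies in every \<open>V\<^sub>j\<close>, then its dilates
  \<open>t \<mapsto> f (2\<^sup>n t)\<close> lie in \<open>V\<^sub>0\<close> up to a unimodular factor, and the lower Riesz bound controls their
  coefficients by their norms. Hence the mass of \<open>f\<close> on \<open>[-R, R]\<close> is bounded by a constant times
  the mass of \<open>\<phi>\<close> within distance \<open>R / 2\<^sup>n\<close> of the integers, which tends to \<open>0\<close> as \<open>n\<close> grows.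
\<close>

section \<open>Linear combinations and products of square-integrable functions\<close>

lemma L2_iff: "f \<in> L2 \<longleftrightarrow>
    f \<in> borel_measurable lebesgue \<and> integrable lebesgue (\<lambda>t. (cmod (f t))\<^sup>2)"
  by (simp add: L2_def)

lemma L2_norm_power2: "(L2_norm f)\<^sup>2 = (LINT t|lebesgue. (cmod (f t))\<^sup>2)"
  by (simp add: L2_norm_def)

lemma cmod_add_power2_le: "(cmod (x + y))\<^sup>2 \<le> 2 * (cmod x)\<^sup>2 + 2 * (cmod y)\<^sup>2"
proof -
  have "(cmod (x + y))\<^sup>2 \<le> (cmod x + cmod y)\<^sup>2"
    by (intro power_mono norm_triangle_ineq) auto
  also have "\<dots> \<le> 2 * (cmod x)\<^sup>2 + 2 * (cmod y)\<^sup>2"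
    using zero_le_power2[of "cmod x - cmod y"] by (simp add: power2_sum power2_diff)
  finally show ?thesis .
qed

lemma L2_add:
  assumes "f \<in> L2" "g \<in> L2"
  shows "(\<lambda>t. f t + g t) \<in> L2"
proof -
  have [measurable]: "f \<in> borel_measurable lebesgue" "g \<in> borel_measurable lebesgue"
    using assms by (auto simp: L2_iff)
  have "integrable lebesgue (\<lambda>t. 2 * (cmod (f t))\<^sup>2 + 2 * (cmod (g t))\<^sup>2)"
    using assms by (auto simp: L2_iff)
  then have "integrable lebesgue (\<lambda>t. (cmod (f t + g t))\<^sup>2)"
    by (rule Bochner_Integration.integrable_bound) (auto simp: cmod_add_power2_le)
  then show ?thesis by (auto simp: L2_iff)
qed

lemma L2_scale: "f \<in> L2 \<Longrightarrow> (\<lambda>t. c * f t) \<in> L2"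
  by (auto simp: L2_iff norm_mult power_mult_distrib)

lemma L2_diff:
  assumes "f \<in> L2" "g \<in> L2"
  shows "(\<lambda>t. f t - g t) \<in> L2"
  using L2_add[OF assms(1) L2_scale[OF assms(2), of "-1"]] by simp

lemma L2_sum: "(\<And>k. k \<in> F \<Longrightarrow> e k \<in> L2) \<Longrightarrow> (\<lambda>t. \<Sum>k\<in>F. e k t) \<in> L2"
  by (induction F rule: infinite_finite_induct) (auto simp: L2_add, auto simp: L2_iff)

lemma borel_measurable_cnj: "cnj \<in> borel_measurable borel"
  by (intro borel_measurable_continuous_onI continuous_intros)

lemma L2_mult_cnj_integrable:
  assumes "f \<in> L2" "g \<in> L2"
  shows "integrable lebesgue (\<lambda>t. f t * cnj (g t))"
proof -
  have [measurable]: "f \<in> borel_measurable lebesgue" "g \<in> borel_measurable lebesgue"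
    using assms by (auto simp: L2_iff)
  have "integrable lebesgue (\<lambda>t. (cmod (f t))\<^sup>2 + (cmod (g t))\<^sup>2)"
    using assms by (auto simp: L2_iff)
  then show ?thesis
  proof (rule Bochner_Integration.integrable_bound)
    show "AE t in lebesgue. norm (f t * cnj (g t)) \<le> norm ((cmod (f t))\<^sup>2 + (cmod (g t))\<^sup>2)"
    proof (rule AE_I2)
      fix t
      have "2 * (cmod (f t) * cmod (g t)) \<le> (cmod (f t))\<^sup>2 + (cmod (g t))\<^sup>2"
        using zero_le_power2[of "cmod (f t) - cmod (g t)"] by (simp add: power2_diff)
      moreover have "0 \<le> cmod (f t) * cmod (g t)" by simp
      ultimately have "cmod (f t) * cmod (g t) \<le> (cmod (f t))\<^sup>2 + (cmod (g t))\<^sup>2" by linarith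
      then show "norm (f t * cnj (g t)) \<le> norm ((cmod (f t))\<^sup>2 + (cmod (g t))\<^sup>2)"
        by (simp add: norm_mult)
    qed
  qed (intro borel_measurable_times measurable_compose[OF _ borel_measurable_cnj], measurable)
qed

section \<open>Coefficient bounds for orthonormal systems\<close>

text \<open>Pythagoras: once the squared modulus is written as the sum times its conjugate,
  orthonormality kills the off-diagonal terms of the double sum.\<close>

lemma orthonormal_sum_norm:
  assumes fin: "finite F" and e: "\<And>k. e k \<in> L2"
    and on: "\<And>j k. L2_inner (e j) (e k) = (if j = k then 1 else 0)"
  shows "(L2_norm (\<lambda>t. \<Sum>k\<in>F. a k * e k t))\<^sup>2 = (\<Sum>k\<in>F. (cmod (a k))\<^sup>2)"
proof -
  let ?S = "\<lambda>t. \<Sum>k\<in>F. a k * e k t"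
  have int: "integrable lebesgue (\<lambda>t. e j t * cnj (e k t))" for j k
    by (intro L2_mult_cnj_integrable e)
  have "complex_of_real ((L2_norm ?S)\<^sup>2) = (LINT t|lebesgue. ?S t * cnj (?S t))"
    unfolding L2_norm_power2 integral_complex_of_real[symmetric] complex_norm_square ..
  also have "\<dots> = (LINT t|lebesgue. (\<Sum>j\<in>F. \<Sum>k\<in>F. (a j * cnj (a k)) * (e j t * cnj (e k t))))"
    by (simp add: sum_product mult_ac)
  also have "\<dots> = (\<Sum>j\<in>F. \<Sum>k\<in>F. (a j * cnj (a k)) * L2_inner (e j) (e k))"
    by (simp add: int L2_inner_def)
  also have "\<dots> = (\<Sum>j\<in>F. a j * cnj (a j))"
    using fin by (simp add: on if_distrib cong: if_cong)
  also have "\<dots> = complex_of_real (\<Sum>k\<in>F. (cmod (a k))\<^sup>2)"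
    by (simp add: complex_norm_square[symmetric])
  finally show ?thesis using of_real_eq_iff by blast
qed

lemma L2_has_sum_power2:
  assumes "L2_has_sum e f"
  shows "((\<lambda>F. (L2_norm (\<lambda>t. (\<Sum>k\<in>F. e k t) - f t))\<^sup>2) \<longlongrightarrow> 0) (finite_subsets_at_top UNIV)"
  using tendsto_power[OF assms[unfolded L2_has_sum_def], of 2] by simp

text \<open>A weak Bessel inequality, giving orthonormal bases the same kind of coefficient control
  as the lower Riesz bound. The factor 2 comes from \<open>cmod_add_power2_le\<close>; any constant
  serves the later argument.\<close>

lemma orthonormal_coeff_bound:
  assumes e: "\<And>k. e k \<in> L2"
    and on: "\<And>j k. L2_inner (e j) (e k) = (if j = k then 1 else 0)"
    and f: "f \<in> L2" and sum: "L2_has_sum (\<lambda>k t. a k * e k t) f" and fin: "finite F"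
  shows "(\<Sum>k\<in>F. (cmod (a k))\<^sup>2) \<le> 2 * (L2_norm f)\<^sup>2"
proof -
  let ?S = "\<lambda>F t. \<Sum>k\<in>F. a k * e k t"
  have S: "?S G \<in> L2" for G by (intro L2_sum L2_scale e)
  \<comment> \<open>\<open>F\<close> is enlarged to \<open>G\<close> so that the partial sum over
    \<open>G\<close> can approach \<open>f\<close>; Pythagoras turns the coefficients over
    \<open>G\<close> into a norm.\<close>
  have bd: "(\<Sum>k\<in>F. (cmod (a k))\<^sup>2)
      \<le> 2 * (L2_norm (\<lambda>t. ?S G t - f t))\<^sup>2 + 2 * (L2_norm f)\<^sup>2" if G: "finite G" "F \<subseteq> G" for G
  proof -
    have D: "(\<lambda>t. ?S G t - f t) \<in> L2" by (intro L2_diff S f)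
    have "(\<Sum>k\<in>F. (cmod (a k))\<^sup>2) \<le> (\<Sum>k\<in>G. (cmod (a k))\<^sup>2)"
      using G by (intro sum_mono2) auto
    also have "\<dots> = (LINT t|lebesgue. (cmod (?S G t))\<^sup>2)"
      using orthonormal_sum_norm[OF G(1) e on, of a] by (simp add: L2_norm_power2)
    also have "\<dots> \<le> (LINT t|lebesgue. 2 * (cmod (?S G t - f t))\<^sup>2 + 2 * (cmod (f t))\<^sup>2)"
    proof (intro integral_mono)
      show "(cmod (?S G t))\<^sup>2 \<le> 2 * (cmod (?S G t - f t))\<^sup>2 + 2 * (cmod (f t))\<^sup>2" for t
        using cmod_add_power2_le[of "?S G t - f t" "f t"] by simp
    qed (use S D f in \<open>auto simp: L2_iff\<close>)
    also have "\<dots> = 2 * (L2_norm (\<lambda>t. ?S G t - f t))\<^sup>2 + 2 * (L2_norm f)\<^sup>2"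
      using D f by (simp add: L2_iff L2_norm_power2)
    finally show ?thesis .
  qed
  \<comment> \<open>Limit along the finite sets \<open>G\<close>, which eventually contain
    \<open>F\<close>: the error term vanishes.\<close>
  have "((\<lambda>G. 2 * (L2_norm (\<lambda>t. ?S G t - f t))\<^sup>2 + 2 * (L2_norm f)\<^sup>2)
      \<longlongrightarrow> 2 * 0 + 2 * (L2_norm f)\<^sup>2) (finite_subsets_at_top UNIV)"
    by (intro tendsto_intros L2_has_sum_power2[OF sum])
  then have "(\<Sum>k\<in>F. (cmod (a k))\<^sup>2) \<le> 2 * 0 + 2 * (L2_norm f)\<^sup>2"
    by (rule tendsto_lowerbound)
       (use fin bd in \<open>auto simp: eventually_finite_subsets_at_top intro!: exI[of _ F]\<close>)
  then show ?thesis by simp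
qed

section \<open>Shrinking neighbourhoods of the integers\<close>

definition int_nbhd :: "real \<Rightarrow> real set" where
  "int_nbhd d = (\<Union>k::int. {of_int k - d..of_int k + d})"

lemma int_nbhd_sets [measurable]: "int_nbhd d \<in> sets lebesgue"
  unfolding int_nbhd_def by (intro sets.countable_UN'') (auto simp: lborelD)

text \<open>Intervals of radius below 1/2 around distinct integers are disjoint, so at most one
  indicator is nonzero at \<open>s\<close>. The centres are \<open>- of_int k\<close> because the
  substitution s = t - k sends \<open>{-d..d}\<close> there.\<close>

lemma sum_indicator_le_int_nbhd:
  assumes "finite F" and "d < 1/2"
  shows "(\<Sum>k\<in>F. indicator {- of_int k - d..- of_int k + d} s) \<le> (indicator (int_nbhd d) s :: real)"
proof -
  let ?I = "\<lambda>k::int. {- of_int k - d..- of_int k + d}"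
  have "disjoint_family_on ?I F"
    unfolding disjoint_family_on_def
  proof (intro ballI impI, rule ccontr)
    fix m n :: int assume "m \<noteq> n" and "?I m \<inter> ?I n \<noteq> {}"
    then obtain x where "x \<in> ?I m" "x \<in> ?I n" by blast
    then have "\<bar>of_int m - of_int n :: real\<bar> < 1" using assms(2) by auto
    then have "\<bar>m - n\<bar> < 1" by linarith
    with \<open>m \<noteq> n\<close> show False by simp
  qed
  then have "(\<Sum>k\<in>F. indicator (?I k) s) = (indicator (\<Union>(?I ` F)) s :: real)"
    using assms(1) by (simp add: indicator_UN_disjoint)
  also have "\<dots> \<le> indicator (int_nbhd d) s"
  proof -
    have indicator_le: "indicator X s \<le> (indicator Y s :: real)" if "X \<subseteq> Y" for X Y :: "real set"
      using that by (auto simp: indicator_def)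
    have "\<Union>(?I ` F) \<subseteq> int_nbhd d"
    proof
      fix x assume "x \<in> \<Union>(?I ` F)"
      then obtain k where "x \<in> ?I k" by blast
      then have "x \<in> {of_int (-k) - d..of_int (-k) + d}" by simp
      then show "x \<in> int_nbhd d" unfolding int_nbhd_def by blast
    qed
    then show ?thesis by (rule indicator_le)
  qed
  finally show ?thesis .
qed

lemma AE_not_int: "AE s in lebesgue. s \<notin> (\<int> :: real set)"
proof -
  have "(\<int> :: real set) \<in> null_sets lborel"
    by (intro countable_imp_null_set_lborel) (simp add: Ints_def)
  then show ?thesis by (intro AE_completion AE_not_in)
qed

text \<open>Dominated convergence with majorant |g|: every point off the null set of integers
  eventually leaves the shrinking neighbourhoods.\<close>

lemma int_nbhd_integral_tendsto_0:
  assumes g: "integrable lebesgue g" and d: "d \<longlonglongrightarrow> 0"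
  shows "(\<lambda>n. LINT s|lebesgue. indicator (int_nbhd (d n)) s * g s) \<longlonglongrightarrow> (0::real)"
proof -
  have [measurable]: "g \<in> borel_measurable lebesgue" using g by auto
  have "(\<lambda>n. LINT s|lebesgue. indicator (int_nbhd (d n)) s * g s)
      \<longlonglongrightarrow> (LINT s::real|lebesgue. (0::real))"
  proof (rule integral_dominated_convergence)
    show "integrable lebesgue (\<lambda>s. \<bar>g s\<bar>)" using g by simp
    show "AE s in lebesgue. (\<lambda>n. indicator (int_nbhd (d n)) s * g s) \<longlonglongrightarrow> 0"
      using AE_not_int
    proof eventually_elim
      case (elim s)
      \<comment> \<open>The distance from \<open>s\<close> to the nearest integer.\<close>
      define \<eta> where "\<eta> = min (s - of_int \<lfloor>s\<rfloor>) (of_int \<lfloor>s\<rfloor> + 1 - s)"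
      have "s \<noteq> of_int \<lfloor>s\<rfloor>" using elim by (metis Ints_of_int)
      then have "0 < \<eta>" unfolding \<eta>_def by linarith
      then have "eventually (\<lambda>n. d n < \<eta>) sequentially"
        by (rule order_tendstoD(2)[OF d])
      then have "eventually (\<lambda>n. indicator (int_nbhd (d n)) s * g s = 0) sequentially"
      proof eventually_elim
        case (elim n)
        have "s \<notin> {of_int k - d n..of_int k + d n}" for k :: int
        \<comment> \<open>Integers up to the floor lie at least \<open>\<eta>\<close> to the left of
          \<open>s\<close>, all others at least \<open>\<eta>\<close> to the right.\<close>
        proof (cases "k \<le> \<lfloor>s\<rfloor>")
          case True
          then have "real_of_int k \<le> of_int \<lfloor>s\<rfloor>" by simp
          then show ?thesis using elim unfolding \<eta>_def by auto
        next
          case False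
          then have "\<lfloor>s\<rfloor> + 1 \<le> k" by simp
          then have "real_of_int \<lfloor>s\<rfloor> + 1 \<le> of_int k" by linarith
          then show ?thesis using elim unfolding \<eta>_def by auto
        qed
        then show ?case by (simp add: int_nbhd_def)
      qed
      then show ?case by (rule tendsto_eventually)
    qed
  qed (auto simp: indicator_def)
  then show ?thesis by simp
qed

section \<open>Local mass of a combination of translates\<close>

text \<open>
  By Cauchy-Schwarz, a combination of translates is dominated pointwise by the square sums of the
  coefficients and of the translates; integrating the latter over a short interval around \<open>0\<close>
  amounts to integrating \<open>\<bar>\<phi>\<bar>\<^sup>2\<close> over disjoint intervals around the integers.
\<close>

lemma translates_local_bound:
  assumes \<phi>: "\<phi> \<in> L2" and e: "\<And>k. e k \<in> L2"
    and abs_e: "\<And>k t. cmod (e k t) = cmod (\<phi> (t - of_int k))"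
    and f: "f \<in> L2" and sum: "L2_has_sum (\<lambda>k t. a k * e k t) f"
    and coeff: "\<And>F. finite F \<Longrightarrow> (\<Sum>k\<in>F. (cmod (a k))\<^sup>2) \<le> A"
    and d: "d < 1/2"
  shows "(LINT t|lebesgue. indicator {-d..d} t * (cmod (f t))\<^sup>2)
    \<le> 2 * A * (LINT s|lebesgue. indicator (int_nbhd d) s * (cmod (\<phi> s))\<^sup>2)"
    (is "?L \<le> 2 * A * ?P")
proof -
  let ?S = "\<lambda>F t. \<Sum>k\<in>F. a k * e k t"
  let ?J = "indicator {-d..d} :: real \<Rightarrow> real"
  have A: "0 \<le> A" using coeff[of "{}"] by simp
  have S: "?S G \<in> L2" for G by (intro L2_sum L2_scale e)
  have ind: "integrable lebesgue (\<lambda>t. indicator X t * (cmod (g t))\<^sup>2)"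
    if "g \<in> L2" "X \<in> sets lebesgue" for g X
    using integrable_mult_indicator[OF that(2), of "\<lambda>t. (cmod (g t))\<^sup>2"] that(1)
    by (simp add: L2_iff)
  have J: "{b..c} \<in> sets lebesgue" for b c :: real by (auto simp: lborelD)
  have trans: "(LINT t|lebesgue. ?J t * (cmod (e k t))\<^sup>2)
      = (LINT s|lebesgue. indicator {- of_int k - d..- of_int k + d} s * (cmod (\<phi> s))\<^sup>2)" for k
  proof -
    have *: "indicator {- of_int k - d..- of_int k + d} (- of_int k + 1 * t) = ?J t" for t
      by (auto simp: indicator_def)
    show ?thesis
      \<comment> \<open>The substitution s = t - k, applied to the right-hand integral.\<close>
      by (subst (2) lebesgue_integral_real_affine[where c = 1 and t = "- of_int k"])
         (simp_all only: * abs_e, simp_all)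
  qed
  have local_sum: "(LINT t|lebesgue. ?J t * (cmod (?S F t))\<^sup>2) \<le> A * ?P" if F: "finite F" for F
  proof -
    have "(LINT t|lebesgue. ?J t * (cmod (?S F t))\<^sup>2)
        \<le> (LINT t|lebesgue. A * (\<Sum>k\<in>F. ?J t * (cmod (e k t))\<^sup>2))"
    proof (intro integral_mono)
      fix t
      have "(cmod (?S F t))\<^sup>2 \<le> (\<Sum>k\<in>F. cmod (a k) * cmod (e k t))\<^sup>2"
        by (intro power_mono order_trans[OF norm_sum]) (auto simp: norm_mult)
      also have "\<dots> \<le> (\<Sum>k\<in>F. (cmod (a k))\<^sup>2) * (\<Sum>k\<in>F. (cmod (e k t))\<^sup>2)"
        by (rule Cauchy_Schwarz_ineq_sum)
      also have "\<dots> \<le> A * (\<Sum>k\<in>F. (cmod (e k t))\<^sup>2)"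
        by (intro mult_right_mono coeff F sum_nonneg) auto
      finally show "?J t * (cmod (?S F t))\<^sup>2 \<le> A * (\<Sum>k\<in>F. ?J t * (cmod (e k t))\<^sup>2)"
        by (auto simp: indicator_def)
    qed (auto intro!: ind S J e)
    also have "\<dots> = A * (\<Sum>k\<in>F. LINT t|lebesgue. ?J t * (cmod (e k t))\<^sup>2)"
      by (simp add: ind e J)
    also have "\<dots> = A * (LINT s|lebesgue.
        (\<Sum>k\<in>F. indicator {- of_int k - d..- of_int k + d} s * (cmod (\<phi> s))\<^sup>2))"
      by (simp add: trans ind \<phi> J)
    \<comment> \<open>With the common factor from \<open>\<phi>\<close> pulled out, disjointness of
      the intervals makes the bound independent of \<open>F\<close>.\<close>
    also have "\<dots> \<le> A * ?P"
      by (intro mult_left_mono A integral_mono Bochner_Integration.integrable_sum ind \<phi> J int_nbhd_sets)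
         (simp only: sum_distrib_right[symmetric], intro mult_right_mono sum_indicator_le_int_nbhd F d, simp)
    finally show ?thesis .
  qed
  have bd: "?L \<le> 2 * (L2_norm (\<lambda>t. ?S F t - f t))\<^sup>2 + 2 * (A * ?P)" if F: "finite F" for F
  proof -
    have D: "(\<lambda>t. ?S F t - f t) \<in> L2" by (intro L2_diff S f)
    \<comment> \<open>Split f = (f - S) + S with S the partial sum. Only the second part keeps the
      interval; the first is integrated over the whole line, which yields the L2 distance.\<close>
    have "?L \<le> (LINT t|lebesgue. 2 * (cmod (?S F t - f t))\<^sup>2 + 2 * (?J t * (cmod (?S F t))\<^sup>2))"
    proof (intro integral_mono)
      show "?J t * (cmod (f t))\<^sup>2 \<le> 2 * (cmod (?S F t - f t))\<^sup>2 + 2 * (?J t * (cmod (?S F t))\<^sup>2)" for t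
        using cmod_add_power2_le[of "f t - ?S F t" "?S F t"]
        by (auto simp: indicator_def norm_minus_commute)
    next
      show "integrable lebesgue (\<lambda>t. 2 * (cmod (?S F t - f t))\<^sup>2 + 2 * (?J t * (cmod (?S F t))\<^sup>2))"
        using D ind[OF S J] by (auto simp: L2_iff)
    qed (rule ind[OF f J])
    also have "\<dots> = 2 * (L2_norm (\<lambda>t. ?S F t - f t))\<^sup>2 + 2 * (LINT t|lebesgue. ?J t * (cmod (?S F t))\<^sup>2)"
      using D ind[OF S J] by (simp add: L2_iff L2_norm_power2)
    also have "\<dots> \<le> 2 * (L2_norm (\<lambda>t. ?S F t - f t))\<^sup>2 + 2 * (A * ?P)"
      using local_sum[OF F] by simp
    finally show ?thesis .
  qed
  \<comment> \<open>As \<open>F\<close> grows, the L2 distance vanishes and the uniform local bound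
    remains.\<close>
  have "((\<lambda>F. 2 * (L2_norm (\<lambda>t. ?S F t - f t))\<^sup>2 + 2 * (A * ?P))
      \<longlongrightarrow> 2 * 0 + 2 * (A * ?P)) (finite_subsets_at_top UNIV)"
    by (intro tendsto_intros L2_has_sum_power2[OF sum])
  then have "?L \<le> 2 * 0 + 2 * (A * ?P)"
    by (rule tendsto_lowerbound)
       (use bd in \<open>auto simp: eventually_finite_subsets_at_top\<close>)
  then show ?thesis by simp
qed

section \<open>Null functions, dilations and the vanishing of the intersection\<close>

text \<open>The constant sequence of zero functions converges in L2 norm to every null function, so
  closedness applies.\<close>

lemma L2_AE_zero_mem_closed_subspace:
  assumes H: "closed_subspace_L2 H" and f: "f \<in> L2" "AE t in lebesgue. f t = 0"
  shows "f \<in> H"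
proof -
  have "(LINT t|lebesgue. (cmod (0 - f t))\<^sup>2) = (LINT t|lebesgue. 0)"
    using f(2) by (simp add: integral_eq_zero_AE)
  then have "L2_norm (\<lambda>t. 0 - f t) = 0" by (simp add: L2_norm_def)
  moreover have "(\<lambda>t. 0) \<in> H"
    and "(\<forall>n::nat. (\<lambda>t. 0) \<in> H) \<and> (\<lambda>n. L2_norm (\<lambda>t. 0 - f t)) \<longlonglongrightarrow> 0 \<longrightarrow> f \<in> H"
    using H f(1) unfolding closed_subspace_L2_def by (blast, meson)
  ultimately show ?thesis by simp
qed

text \<open>Each dilation raises the index by one. Tracking only moduli avoids composing the chirp
  factors.\<close>

lemma dilate_iterate:
  fixes V :: "int \<Rightarrow> (real \<Rightarrow> complex) set"
  assumes dil: "\<And>k f. f \<in> V k \<Longrightarrow> \<exists>g\<in>V (k + 1). \<forall>t. cmod (g t) = cmod (f (2 * t))"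
    and f: "f \<in> V (- int n)"
  shows "\<exists>g\<in>V 0. \<forall>t. cmod (g t) = cmod (f (2 ^ n * t))"
  using f
proof (induction n arbitrary: f)
  case 0
  then show ?case by (intro bexI[of _ f]) simp_all
next
  case (Suc n)
  \<comment> \<open>One dilation takes index -(n+1) to -n; the induction hypothesis is then applied
    to the new function, which is why \<open>f\<close> is arbitrary.\<close>
  obtain g where g: "g \<in> V (- int n)" "\<And>t. cmod (g t) = cmod (f (2 * t))"
    using dil[OF Suc.prems] by auto
  then show ?case using Suc.IH[OF g(1)] by (auto simp: mult_ac)
qed

text \<open>The common core of both cases: a basis enters only through the moduli of its members and
  a coefficient bound with some constant \<open>C\<close>.\<close>

lemma Inter_dilates_AE_zero:
  fixes V :: "int \<Rightarrow> (real \<Rightarrow> complex) set"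
  assumes V: "V 0 \<subseteq> L2"
    and dil: "\<And>k f. f \<in> V k \<Longrightarrow> \<exists>g\<in>V (k + 1). \<forall>t. cmod (g t) = cmod (f (2 * t))"
    and \<phi>: "\<phi> \<in> L2" and e: "\<And>k. e k \<in> L2"
    and abs_e: "\<And>k t. cmod (e k t) = cmod (\<phi> (t - of_int k))"
    and C: "0 \<le> C"
    and basis: "\<And>g. g \<in> V 0 \<Longrightarrow> \<exists>a. L2_has_sum (\<lambda>k t. a k * e k t) g \<and>
      (\<forall>F. finite F \<longrightarrow> (\<Sum>k\<in>F. (cmod (a k))\<^sup>2) \<le> C * (L2_norm g)\<^sup>2)"
    and f: "f \<in> (\<Inter>j. V j)"
  shows "AE t in lebesgue. f t = 0"
proof -
  have fL2: "f \<in> L2" using f V by auto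
  have [measurable]: "f \<in> borel_measurable lebesgue" using fL2 by (simp add: L2_iff)
  have J: "{b..c} \<in> sets lebesgue" for b c :: real by (auto simp: lborelD)
  define P where "P d = (LINT s|lebesgue. indicator (int_nbhd d) s * (cmod (\<phi> s))\<^sup>2)" for d
  have int0: "(LINT t|lebesgue. indicator {-R..R} t * (cmod (f t))\<^sup>2) \<le> 0" for R :: real
  proof -
    \<comment> \<open>Rescaling by \<open>2 ^ n\<close> shrinks [-R, R] to radius
      \<open>d n\<close>, which is eventually below 1/2, as disjointness of the intervals
      demands.\<close>
    define d where "d n = R / 2 ^ n" for n :: nat
    have d0: "d \<longlonglongrightarrow> 0"
      unfolding d_def by (rule LIMSEQ_divide_realpow_zero) simp
    have "(\<lambda>n. P (d n)) \<longlonglongrightarrow> 0"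
      unfolding P_def using \<phi> d0 by (intro int_nbhd_integral_tendsto_0) (auto simp: L2_iff)
    then have "(\<lambda>n. 2 * C * (L2_norm f)\<^sup>2 * P (d n)) \<longlonglongrightarrow> 0"
      by (rule tendsto_mult_right_zero)
    moreover have "eventually (\<lambda>n. (LINT t|lebesgue. indicator {-R..R} t * (cmod (f t))\<^sup>2)
        \<le> 2 * C * (L2_norm f)\<^sup>2 * P (d n)) sequentially"
    proof -
      have "eventually (\<lambda>n. d n < 1/2) sequentially"
        by (rule order_tendstoD(2)[OF d0]) simp
      then show ?thesis
      proof eventually_elim
        case (elim n)
        obtain g where g: "g \<in> V 0" "\<And>t. cmod (g t) = cmod (f (2 ^ n * t))"
          using dilate_iterate[of V f n] dil f by blast
        obtain a where a: "L2_has_sum (\<lambda>k t. a k * e k t) g"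
          "\<And>F. finite F \<Longrightarrow> (\<Sum>k\<in>F. (cmod (a k))\<^sup>2) \<le> C * (L2_norm g)\<^sup>2"
          using basis[OF g(1)] by blast
        \<comment> \<open>The substitution t -> \<open>2 ^ n * t\<close>; for non-integrable
          \<open>h\<close> both sides are 0 by default.\<close>
        have scale: "(LINT t|lebesgue. h t) = 2 ^ n * (LINT t|lebesgue. h (2 ^ n * t))"
          for h :: "real \<Rightarrow> real"
          using lebesgue_integral_real_affine[of "2 ^ n" h 0] by simp
        have ind: "indicator {-R..R} (2 ^ n * t) = (indicator {-d n..d n} t :: real)" for t
          unfolding d_def by (auto simp: indicator_def field_simps)
        have norm: "(L2_norm f)\<^sup>2 = 2 ^ n * (L2_norm g)\<^sup>2"
          unfolding L2_norm_power2 g(2) by (rule scale)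
        have "(LINT t|lebesgue. indicator {-R..R} t * (cmod (f t))\<^sup>2)
            = 2 ^ n * (LINT t|lebesgue. indicator {-d n..d n} t * (cmod (g t))\<^sup>2)"
          by (subst scale) (simp only: ind g(2))
        \<comment> \<open>The local bound with \<open>A\<close> equal to
          \<open>C * (L2_norm g)\<^sup>2\<close>. The factor \<open>2 ^ n\<close> is then absorbed
          in passing from the norm of \<open>g\<close> to that of \<open>f\<close>, so only
          \<open>P (d n)\<close> still depends on \<open>n\<close>.\<close>
        also have "\<dots> \<le> 2 ^ n * (2 * (C * (L2_norm g)\<^sup>2) * P (d n))"
          unfolding P_def using g(1) V elim
          by (intro mult_left_mono translates_local_bound[OF \<phi> e abs_e _ a]) auto
        also have "\<dots> = 2 * C * (L2_norm f)\<^sup>2 * P (d n)"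
          by (simp add: norm)
        finally show ?case .
      qed
    qed
    ultimately show ?thesis by (intro tendsto_lowerbound) auto
  qed
  have "AE t in lebesgue. indicator {-real n..real n} t * (cmod (f t))\<^sup>2 = 0" for n
  proof -
    have i: "integrable lebesgue (\<lambda>t. indicator {-real n..real n} t * (cmod (f t))\<^sup>2)"
      using integrable_mult_indicator[OF J, of "\<lambda>t. (cmod (f t))\<^sup>2"] fL2 by (simp add: L2_iff)
    have "(LINT t|lebesgue. indicator {-real n..real n} t * (cmod (f t))\<^sup>2) = 0"
      using int0[of "real n"] by (intro antisym integral_nonneg) auto
    then show ?thesis
      using integral_nonneg_eq_0_iff_AE[OF i] by simp
  qed
  \<comment> \<open>Countably many null sets are merged; the intervals [-n, n] exhaust the
    line.\<close>
  then have "AE t in lebesgue. \<forall>n. indicator {-real n..real n} t * (cmod (f t))\<^sup>2 = 0"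
    by (subst AE_all_countable) (rule allI)
  then show ?thesis
  proof eventually_elim
    case (elim t)
    obtain n where "\<bar>t\<bar> \<le> real n" using real_arch_simple by blast
    then show ?case using elim[rule_format, of n] by (auto simp: indicator_def split: if_splits)
  qed
qed

section \<open>Trivial intersection for orthonormal and Riesz generators\<close>

theorem theorem4p1:
  fixes \<alpha> :: real
    and V :: "int \<Rightarrow> (real \<Rightarrow> complex) set"
  assumes "\<not> (\<exists>m::int. \<alpha> = of_int m * pi)"
    and "\<And>k. closed_subspace_L2 (V k)"
    and "\<And>k. V k \<subseteq> V (k + 1)"
    and "\<And>k f. f \<in> V k \<longleftrightarrow>
           (\<lambda>t. f (2 * t) * exp (\<i> / 2 * complex_of_real (((2 * t)\<^sup>2 - t\<^sup>2) * cot \<alpha>))) \<in> V (k + 1)"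
  shows "((\<exists>\<phi>\<in>V 0. orthonormal_basis_L2 (V 0) (chirp_translate \<alpha> \<phi>)) \<longrightarrow>
            (\<Inter>j. V j) = {f \<in> L2. AE t in lebesgue. f t = 0})
       \<and> ((\<exists>\<phi>\<in>V 0. riesz_basis_L2 (V 0) (chirp_translate \<alpha> \<phi>)) \<longrightarrow>
            (\<Inter>j. V j) = {f \<in> L2. AE t in lebesgue. f t = 0})"
proof -
  have VL2: "V k \<subseteq> L2" for k using assms(2)[of k] by (simp add: closed_subspace_L2_def)
  \<comment> \<open>The witness is the chirped dilate from the two-scale condition; its exponent is
    purely imaginary, so the factor has modulus 1.\<close>
  have dil: "\<exists>g\<in>V (k + 1). \<forall>t. cmod (g t) = cmod (f (2 * t))" if "f \<in> V k" for k f
    using that unfolding assms(4)[of f k]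
    by (rule bexI[rotated]) (simp add: norm_mult)
  have abs_e: "cmod (chirp_translate \<alpha> \<phi> k t) = cmod (\<phi> (t - of_int k))" for \<phi> k t
    by (simp add: chirp_translate_def norm_mult)
  have eq: "(\<Inter>j. V j) = {f \<in> L2. AE t in lebesgue. f t = 0}"
    if \<phi>: "\<phi> \<in> V 0" and e: "\<And>k. chirp_translate \<alpha> \<phi> k \<in> V 0" and C: "0 \<le> C"
      and basis: "\<And>g. g \<in> V 0 \<Longrightarrow> \<exists>a. L2_has_sum (\<lambda>k t. a k * chirp_translate \<alpha> \<phi> k t) g \<and>
        (\<forall>F. finite F \<longrightarrow> (\<Sum>k\<in>F. (cmod (a k))\<^sup>2) \<le> C * (L2_norm g)\<^sup>2)" for \<phi> and C :: real
  proof (intro equalityI subsetI)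
    fix f assume f: "f \<in> (\<Inter>j. V j)"
    have "AE t in lebesgue. f t = 0"
      using VL2 \<phi> e
      by (intro Inter_dilates_AE_zero[OF VL2 dil _ _ abs_e C basis f]) auto
    then show "f \<in> {f \<in> L2. AE t in lebesgue. f t = 0}" using f VL2 by auto
  next
    fix f assume "f \<in> {f \<in> L2. AE t in lebesgue. f t = 0}"
    then show "f \<in> (\<Inter>j. V j)" using L2_AE_zero_mem_closed_subspace[OF assms(2)] by auto
  qed
  show ?thesis
  proof (intro conjI impI)
    assume "\<exists>\<phi>\<in>V 0. orthonormal_basis_L2 (V 0) (chirp_translate \<alpha> \<phi>)"
    then obtain \<phi> where \<phi>: "\<phi> \<in> V 0" and e: "\<And>k. chirp_translate \<alpha> \<phi> k \<in> V 0"
      and on: "\<And>j k. L2_inner (chirp_translate \<alpha> \<phi> j) (chirp_translate \<alpha> \<phi> k)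
        = (if j = k then 1 else 0)"
      and ex: "\<And>g. g \<in> V 0 \<Longrightarrow> \<exists>a. L2_has_sum (\<lambda>k t. a k * chirp_translate \<alpha> \<phi> k t) g"
      unfolding orthonormal_basis_L2_def by blast
    show "(\<Inter>j. V j) = {f \<in> L2. AE t in lebesgue. f t = 0}"
    \<comment> \<open>2 is the constant of the weak Bessel inequality.\<close>
    proof (rule eq[OF \<phi> e, of 2])
      fix g assume g: "g \<in> V 0"
      obtain a where a: "L2_has_sum (\<lambda>k t. a k * chirp_translate \<alpha> \<phi> k t) g"
        using ex[OF g] by blast
      have "(\<Sum>k\<in>F. (cmod (a k))\<^sup>2) \<le> 2 * (L2_norm g)\<^sup>2" if "finite F" for F
        using VL2 e g by (intro orthonormal_coeff_bound[OF _ on _ a that]) auto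
      with a show "\<exists>a. L2_has_sum (\<lambda>k t. a k * chirp_translate \<alpha> \<phi> k t) g \<and>
        (\<forall>F. finite F \<longrightarrow> (\<Sum>k\<in>F. (cmod (a k))\<^sup>2) \<le> 2 * (L2_norm g)\<^sup>2)" by blast
    qed simp
  next
    assume "\<exists>\<phi>\<in>V 0. riesz_basis_L2 (V 0) (chirp_translate \<alpha> \<phi>)"
    then obtain \<phi> C where \<phi>: "\<phi> \<in> V 0" and e: "\<And>k. chirp_translate \<alpha> \<phi> k \<in> V 0"
      and C: "0 < C"
      and ex: "\<And>g. g \<in> V 0 \<Longrightarrow> \<exists>a. (\<lambda>k. (cmod (a k))\<^sup>2) summable_on UNIV \<and>
        L2_has_sum (\<lambda>k t. a k * chirp_translate \<alpha> \<phi> k t) g \<and>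
        C * (\<Sum>\<^sub>\<infinity>k. (cmod (a k))\<^sup>2) \<le> (L2_norm g)\<^sup>2"
      unfolding riesz_basis_L2_def by meson
    show "(\<Inter>j. V j) = {f \<in> L2. AE t in lebesgue. f t = 0}"
    \<comment> \<open>\<open>C\<close> is the lower Riesz constant; finite sums of squared
      coefficients lie below the infinite sum, hence the constant \<open>1 / C\<close>.\<close>
    proof (rule eq[OF \<phi> e, of "1 / C"])
      fix g assume g: "g \<in> V 0"
      obtain a where sm: "(\<lambda>k. (cmod (a k))\<^sup>2) summable_on UNIV"
        and a: "L2_has_sum (\<lambda>k t. a k * chirp_translate \<alpha> \<phi> k t) g"
        and le: "C * (\<Sum>\<^sub>\<infinity>k. (cmod (a k))\<^sup>2) \<le> (L2_norm g)\<^sup>2"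
        using ex[OF g] by blast
      have "(\<Sum>k\<in>F. (cmod (a k))\<^sup>2) \<le> 1 / C * (L2_norm g)\<^sup>2" if "finite F" for F
      proof -
        have "(\<Sum>k\<in>F. (cmod (a k))\<^sup>2) \<le> (\<Sum>\<^sub>\<infinity>k. (cmod (a k))\<^sup>2)"
          by (intro finite_sum_le_infsum sm that) auto
        also have "\<dots> \<le> 1 / C * (L2_norm g)\<^sup>2"
          using le C by (simp add: field_simps)
        finally show ?thesis .
      qed
      with a show "\<exists>a. L2_has_sum (\<lambda>k t. a k * chirp_translate \<alpha> \<phi> k t) g \<and>
        (\<forall>F. finite F \<longrightarrow> (\<Sum>k\<in>F. (cmod (a k))\<^sup>2) \<le> 1 / C * (L2_norm g)\<^sup>2)" by blast
    qed (use C in simp)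
  qed
qed

end
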